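(* Let $H$ be a directed $m$-uniform hypergraph on $n$ vertices and let $A_H^+$ be its out-adjacency hypermatrix. If $\lambda$ is an $H^+$-eigenvalue of $A_H^+$, then $\lambda\ge 0$.
   Context: $M_{m,n}$ is the set of real hypermatrices (tensors) $A=(a_{i_1i_2\dots i_m})$, $1\le i_1,\dots,i_m\le n$. For a vector $x$, $Ax^{m-1}$ is the vector with $i$-th entry $\sum_{i_2,\dots,i_m=1}^n a_{ii_2\dots i_m}x_{i_2}\cdots x_{i_m}$, and $x^{[m-1]}$ is the vector with $i$-th entry $x_i^{m-1}$. For nonzero $A$, a real number $\lambda$ is an $H^+$-eigenvalue if there is a nonzero $x\in\mathbb R^n$ with all entries non-negative such that $Ax^{m-1}=\lambda x^{[m-1]}$. A directed hypergraph $H=(V,E)$ has a finite vertex set $V=\{v_1,\dots,v_n\}$ and a set $E$ of edges; each edge $e$ is a subset of $V$ with a partition $e=T_e\sqcup H_e$ into a nonempty tail $T_e$ and a nonempty head $H_e$, and distinct edges $e_1\ne e_2$ satisfy $T_{e_1}\cup H_{e_1}\neq T_{e_2}\cup H_{e_2}$. It is $m$-uniform if $|e|=m$ for all $e\in E$. Out-adjacency hypermatrix $A_H^+=(a^+_{i_1\dots i_m})\in M_{m,n}$ of a directed $m$-uniform hypergraph: for each edge $e$ with $|T_e|=k$, $a^+_{i_1\dots i_m}=\frac{1}{(m-k)!\,(k-1)!}$ whenever $(v_{i_1},\dots,v_{i_k})$ is an ordering of all the elements of $T_e$ and $(v_{i_{k+1}},\dots,v_{i_m})$ is an ordering of all the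 elements of $H_e$; all other entries are $0$. *)

theory Defs
  imports "HOL-Analysis.Analysis" "HOL-Combinatorics.Multiset_Permutations"
begin

(* An element of M_{m,n} is a function on index lists; only its values on lists of length m
   matter.  The index set {1..n} is the universe of the finite type 'n, so n = CARD('n). *)
type_synonym 'n hypermatrix = "'n list \<Rightarrow> real"

definition nonzero_hypermatrix :: "nat \<Rightarrow> 'n hypermatrix \<Rightarrow> bool" where
  "nonzero_hypermatrix m A \<longleftrightarrow> (\<exists>is. length is = m \<and> A is \<noteq> 0)"

definition hypermatrix_apply :: "nat \<Rightarrow> 'n::finite hypermatrix \<Rightarrow> real ^ 'n \<Rightarrow> real ^ 'n" where
  "hypermatrix_apply m A x =
     (\<chi> i. \<Sum>js | length js = m - 1. A (i # js) * (\<Prod>j\<leftarrow>js. x $ j))"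

definition vec_pow :: "real ^ 'n::finite \<Rightarrow> nat \<Rightarrow> real ^ 'n" where
  "vec_pow x k = (\<chi> i. (x $ i) ^ k)"

definition H_plus_eigenvalue :: "nat \<Rightarrow> 'n::finite hypermatrix \<Rightarrow> real \<Rightarrow> bool" where
  "H_plus_eigenvalue m A l \<longleftrightarrow>
     nonzero_hypermatrix m A \<and>
     (\<exists>x :: real ^ 'n. x \<noteq> 0 \<and> (\<forall>i. 0 \<le> x $ i) \<and>
        hypermatrix_apply m A x = l *\<^sub>R vec_pow x (m - 1))"

(* A directed edge is the pair (tail, head) of its partition. *)
type_synonym 'v diedge = "'v set \<times> 'v set"

locale directed_hypergraph =
  fixes V :: "'v set" and E :: "'v diedge set"
  assumes finite_verts: "finite V"
    and edge_subset: "(T, H) \<in> E \<Longrightarrow> T \<union> H \<subseteq> V"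
    and tail_nonempty: "(T, H) \<in> E \<Longrightarrow> T \<noteq> {}"
    and head_nonempty: "(T, H) \<in> E \<Longrightarrow> H \<noteq> {}"
    and tail_head_disjoint: "(T, H) \<in> E \<Longrightarrow> T \<inter> H = {}"
    and edges_distinct:
      "\<lbrakk>(T, H) \<in> E; (T', H') \<in> E; (T, H) \<noteq> (T', H')\<rbrakk> \<Longrightarrow> T \<union> H \<noteq> T' \<union> H'"

locale uniform_directed_hypergraph = directed_hypergraph V E
  for m :: nat and V :: "'v set" and E :: "'v diedge set" +
  assumes uniform: "(T, H) \<in> E \<Longrightarrow> card (T \<union> H) = m"

(* With v enumerating the vertices, the index list is = (i_1, ..., i_m) lists first all elements
   of the tail T, then all elements of the head H. *)
definition orders_edge :: "('n \<Rightarrow> 'v) \<Rightarrow> 'n list \<Rightarrow> 'v diedge \<Rightarrow> bool" where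
  "orders_edge v is e \<longleftrightarrow> (case e of (T, H) \<Rightarrow>
     map v (take (card T) is) \<in> permutations_of_set T \<and>
     map v (drop (card T) is) \<in> permutations_of_set H)"

(* The edge selected by THE is unique in a directed hypergraph; see orders_edge_unique and
   out_adjacency_edge. *)
definition out_adjacency :: "nat \<Rightarrow> ('n \<Rightarrow> 'v) \<Rightarrow> 'v diedge set \<Rightarrow> 'n hypermatrix" where
  "out_adjacency m v E is =
     (if \<exists>e\<in>E. orders_edge v is e
      then let k = card (fst (THE e. e \<in> E \<and> orders_edge v is e))
           in 1 / (fact (m - k) * fact (k - 1))
      else 0)"

lemma orders_edge_set:
  assumes "orders_edge v is (T, H)"
  shows "v ` set is = T \<union> H"
proof -
  have "v ` set (take (card T) is) = T" "v ` set (drop (card T) is) = H"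
    using assms by (auto simp: orders_edge_def permutations_of_set_def)
  moreover have "set is = set (take (card T) is) \<union> set (drop (card T) is)"
    by (metis append_take_drop_id set_append)
  ultimately show ?thesis by (simp add: image_Un)
qed

lemma (in directed_hypergraph) orders_edge_unique:
  assumes "e \<in> E" "e' \<in> E" "orders_edge v is e" "orders_edge v is e'"
  shows "e = e'"
  using assms edges_distinct orders_edge_set by (metis surj_pair)

lemma (in directed_hypergraph) out_adjacency_edge:
  assumes "(T, H) \<in> E" "orders_edge v is (T, H)"
  shows "out_adjacency m v E is = 1 / (fact (m - card T) * fact (card T - 1))"
proof -
  have "(THE e. e \<in> E \<and> orders_edge v is e) = (T, H)"
    using assms orders_edge_unique by (intro the_equality) blast+
  then show ?thesis using assms by (auto simp: out_adjacency_def Let_def)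
qed

end

theory Submission imports Defs begin

text \<open>
  The out-adjacency hypermatrix has non-negative entries, and every \<open>H\<^sup>+\<close>-eigenvalue of such a
  hypermatrix is non-negative: at an index \<open>i\<close> where the eigenvector \<open>x\<close> is positive, the eigenvalue
  equation equates \<open>l * x\<^sub>i ^ (m - 1)\<close>, whose second factor is positive, with a sum of products of
  non-negative numbers.
\<close>

lemma hypermatrix_apply_nonneg:
  fixes x :: "real ^ 'n::finite"
  assumes "\<And>is. 0 \<le> A is" and "\<And>i. 0 \<le> x $ i"
  shows "0 \<le> hypermatrix_apply m A x $ i"
  unfolding hypermatrix_apply_def
  by (auto intro!: sum_nonneg mult_nonneg_nonneg prod_list_nonneg assms)

lemma H_plus_eigenvalue_nonneg:
  fixes A :: "'n::finite hypermatrix"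
  assumes "\<And>is. 0 \<le> A is" and "H_plus_eigenvalue m A l"
  shows "0 \<le> l"
proof -
  obtain x :: "real ^ 'n" where "x \<noteq> 0" and nonneg: "\<And>i. 0 \<le> x $ i"
    and eigen: "hypermatrix_apply m A x = l *\<^sub>R vec_pow x (m - 1)"
    using assms(2) unfolding H_plus_eigenvalue_def by blast
  obtain i where "x $ i \<noteq> 0"
    using \<open>x \<noteq> 0\<close> by (auto simp: vec_eq_iff)
  then have "0 < (x $ i) ^ (m - 1)"
    using nonneg[of i] by simp
  moreover have "0 \<le> l * (x $ i) ^ (m - 1)"
    using hypermatrix_apply_nonneg[of A x m i] assms(1) nonneg eigen
    by (simp add: vec_pow_def)
  ultimately show ?thesis
    by (simp add: zero_le_mult_iff)
qed

lemma out_adjacency_nonneg: "0 \<le> out_adjacency m v E is"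
  by (simp add: out_adjacency_def Let_def)

theorem theorem6:
  fixes m :: nat
    and V :: "'v set"
    and E :: "'v diedge set"
    and v :: "'n::finite \<Rightarrow> 'v"
    and l :: real
  assumes "uniform_directed_hypergraph m V E"
    and "bij_betw v UNIV V"
    and "H_plus_eigenvalue m (out_adjacency m v E) l"
  shows "l \<ge> 0"
  using out_adjacency_nonneg assms(3) by (rule H_plus_eigenvalue_nonneg)

end
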